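(* Let $r\ge1$, $s\ge2$, and let $P_1(\underline{x}),\ldots,P_s(\underline{x})\in\mathbb{Z}[\underline{x}]$ be nonzero polynomials in $r$ variables $\underline{x}=(x_1,\ldots,x_r)$. Let $\ell=\max(\deg P_1,\ldots,\deg P_s)$, let $S$ be a nonempty finite subset of $\mathbb{Z}$, and let $k>0$ be a real number. For $\underline{n}\in\mathbb{Z}^r$ put $d_{\underline{n}}=\gcd(P_1(\underline{n}),\ldots,P_s(\underline{n}))$. If $$\frac{\#\{\underline{n}\in S^r\mid d_{\underline{n}}\le k\}}{\#S^r}>\frac{(2k+1)\,\ell}{\#S},$$ then $P_1(\underline{x}),\ldots,P_s(\underline{x})$ are coprime polynomials.
   Context: Polynomials $P_1,\ldots,P_s\in\mathbb{Z}[\underline{x}]$ are called coprime if no polynomial $D\in\mathbb{Q}[\underline{x}]$ with $\deg D>0$ divides all of them in $\mathbb{Q}[\underline{x}]$. Degrees are total degrees. The gcd of integers is the nonnegative one, with $\gcd(0,\ldots,0)=0$. *)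

theory Defs
  imports Complex_Main "HOL-Library.Poly_Mapping" "HOL-Library.FuncSet"
begin

text \<open>
  A polynomial is a finitely supported map from monomials to coefficients, a monomial being a
  finitely supported map from variable indices to exponents; the ring operations on this type
  come from \<^theory>\<open>HOL-Library.Poly_Mapping\<close>. The type has countably many variables, so
  \<open>r\<close> is fixed by the carrier \<open>mpolys r\<close>, the polynomials in $x_1, \ldots, x_r$.
\<close>

type_synonym monomial = "nat \<Rightarrow>\<^sub>0 nat"

type_synonym 'a mpoly = "monomial \<Rightarrow>\<^sub>0 'a"

definition mpolys :: "nat \<Rightarrow> 'a::zero mpoly set" where
  "mpolys r = {p. \<forall>m\<in>Poly_Mapping.keys p. Poly_Mapping.keys m \<subseteq> {1..r}}"

definition monomial_degree :: "monomial \<Rightarrow> nat" where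
  "monomial_degree m = (\<Sum>j\<in>Poly_Mapping.keys m. Poly_Mapping.lookup m j)"

text \<open>The zero polynomial gets total degree \<open>0\<close>.\<close>

definition total_degree :: "'a::zero mpoly \<Rightarrow> nat" where
  "total_degree p = Max (insert 0 (monomial_degree ` Poly_Mapping.keys p))"

definition mpoly_eval :: "'a::comm_semiring_1 mpoly \<Rightarrow> (nat \<Rightarrow> 'a) \<Rightarrow> 'a" where
  "mpoly_eval p x =
    (\<Sum>m\<in>Poly_Mapping.keys p.
      Poly_Mapping.lookup p m * (\<Prod>j\<in>Poly_Mapping.keys m. x j ^ Poly_Mapping.lookup m j))"

definition rat_mpoly :: "int mpoly \<Rightarrow> rat mpoly" where
  "rat_mpoly p = Poly_Mapping.map of_int p"

definition mpoly_dvd :: "nat \<Rightarrow> rat mpoly \<Rightarrow> rat mpoly \<Rightarrow> bool" where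
  "mpoly_dvd r p q \<longleftrightarrow> (\<exists>c\<in>mpolys r. q = p * c)"

definition coprime_mpolys :: "nat \<Rightarrow> int mpoly set \<Rightarrow> bool" where
  "coprime_mpolys r A \<longleftrightarrow>
    \<not> (\<exists>D\<in>mpolys r. total_degree D > 0 \<and> (\<forall>p\<in>A. mpoly_dvd r D (rat_mpoly p)))"

end

theory Submission
  imports Defs "HOL-Computational_Algebra.Polynomial" "HOL-Computational_Algebra.Primes"
begin

text \<open>
  A nonconstant common divisor over the rationals can be replaced, by Gauss's lemma, by a
  nonconstant \<open>G\<close> with integer coefficients dividing all \<open>P i\<close> over the integers. Then \<open>G n\<close>
  divides \<open>d n\<close>, so \<open>d n \<le> k\<close> forces either \<open>P 1 n = 0\<close> or \<open>G n = c\<close> for one of the at most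
  \<open>2 * k\<close> nonzero integers \<open>c\<close> with \<open>\<bar>c\<bar> \<le> k\<close>. By the Schwartz--Zippel bound each of these at
  most \<open>2 * k + 1\<close> conditions holds on at most a proportion \<open>l / card S\<close> of the grid.
\<close>

subsection \<open>Evaluation\<close>

text \<open>Key sets change under addition and cancellation. Extending the sum to a common finite
  set of monomials is harmless because the extra coefficients are 0.\<close>

lemma mpoly_eval_superset:
  assumes "finite K" and "Poly_Mapping.keys p \<subseteq> K"
  shows "mpoly_eval p x =
    (\<Sum>m\<in>K. Poly_Mapping.lookup p m * (\<Prod>j\<in>Poly_Mapping.keys m. x j ^ Poly_Mapping.lookup m j))"
  unfolding mpoly_eval_def
  using assms by (intro sum.mono_neutral_left) (auto simp: in_keys_iff)

lemma mpoly_eval_zero [simp]: "mpoly_eval 0 x = 0"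
  by (simp add: mpoly_eval_def)

lemma mpoly_eval_single:
  "mpoly_eval (Poly_Mapping.single m c) x =
    c * (\<Prod>j\<in>Poly_Mapping.keys m. x j ^ Poly_Mapping.lookup m j)"
  by (simp add: mpoly_eval_superset[of "{m}"])

lemma mpoly_eval_add: "mpoly_eval (p + q) x = mpoly_eval p x + mpoly_eval q x"
proof -
  let ?K = "Poly_Mapping.keys p \<union> Poly_Mapping.keys q"
  have "Poly_Mapping.keys (p + q) \<subseteq> ?K"
    by (rule Poly_Mapping.keys_add)
  then show ?thesis
    by (simp add: mpoly_eval_superset[of ?K] lookup_add distrib_right sum.distrib)
qed

lemma mpoly_eval_diff:
  fixes p q :: "'a::comm_ring_1 mpoly"
  shows "mpoly_eval (p - q) x = mpoly_eval p x - mpoly_eval q x"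
  using mpoly_eval_add[of "p - q" q x] by simp

lemma mpoly_eval_sum: "mpoly_eval (\<Sum>i\<in>A. p i) x = (\<Sum>i\<in>A. mpoly_eval (p i) x)"
  by (induction A rule: infinite_finite_induct) (auto simp: mpoly_eval_add)

text \<open>The extra factors are \<open>x j ^ 0 = 1\<close>, so two monomials can be compared over
  a common set of variables.\<close>

lemma monomial_value_superset:
  fixes x :: "nat \<Rightarrow> 'a::comm_semiring_1"
  assumes "finite J" and "Poly_Mapping.keys m \<subseteq> J"
  shows "(\<Prod>j\<in>Poly_Mapping.keys m. x j ^ Poly_Mapping.lookup m j) =
    (\<Prod>j\<in>J. x j ^ Poly_Mapping.lookup m j)"
  using assms by (intro prod.mono_neutral_left) (auto simp: in_keys_iff)

lemma monomial_value_add: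
  fixes x :: "nat \<Rightarrow> 'a::comm_semiring_1"
  shows "(\<Prod>j\<in>Poly_Mapping.keys (m + n). x j ^ Poly_Mapping.lookup (m + n) j) =
    (\<Prod>j\<in>Poly_Mapping.keys m. x j ^ Poly_Mapping.lookup m j) *
    (\<Prod>j\<in>Poly_Mapping.keys n. x j ^ Poly_Mapping.lookup n j)"
proof -
  let ?J = "Poly_Mapping.keys m \<union> Poly_Mapping.keys n"
  have "Poly_Mapping.keys (m + n) \<subseteq> ?J"
    by (rule Poly_Mapping.keys_add)
  then show ?thesis
    using monomial_value_superset[of ?J "m + n" x] monomial_value_superset[of ?J m x]
      monomial_value_superset[of ?J n x]
    by (simp add: lookup_add power_add prod.distrib)
qed

lemma poly_mapping_sum_single:
  fixes f :: "'a \<Rightarrow>\<^sub>0 'b::comm_monoid_add"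
  shows "f = (\<Sum>m\<in>Poly_Mapping.keys f. Poly_Mapping.single m (Poly_Mapping.lookup f m))"
proof (rule poly_mapping_eqI)
  fix k
  have "(\<Sum>m\<in>Poly_Mapping.keys f. Poly_Mapping.lookup (Poly_Mapping.single m (Poly_Mapping.lookup f m)) k)
      = (\<Sum>m\<in>Poly_Mapping.keys f. if m = k then Poly_Mapping.lookup f k else 0)"
    by (intro sum.cong) (auto simp: lookup_single when_def)
  also have "\<dots> = Poly_Mapping.lookup f k"
    by (simp add: in_keys_iff)
  finally show "Poly_Mapping.lookup f k = Poly_Mapping.lookup
      (\<Sum>m\<in>Poly_Mapping.keys f. Poly_Mapping.single m (Poly_Mapping.lookup f m)) k"
    by (simp add: lookup_sum)
qed

text \<open>Bilinearity turns the convolution product into a finite double sum of single terms;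
  evaluation, coefficients modulo \<open>q\<close> and the passage to rational coefficients are all
  computed from it.\<close>

lemma poly_mapping_mult_sum_single:
  fixes f g :: "'a::monoid_add \<Rightarrow>\<^sub>0 'b::semiring_0"
  shows "f * g = (\<Sum>m\<in>Poly_Mapping.keys f. \<Sum>n\<in>Poly_Mapping.keys g.
    Poly_Mapping.single (m + n) (Poly_Mapping.lookup f m * Poly_Mapping.lookup g n))"
proof -
  have "f * g = (\<Sum>m\<in>Poly_Mapping.keys f. Poly_Mapping.single m (Poly_Mapping.lookup f m)) *
      (\<Sum>n\<in>Poly_Mapping.keys g. Poly_Mapping.single n (Poly_Mapping.lookup g n))"
    using poly_mapping_sum_single[of f] poly_mapping_sum_single[of g] by simp
  then show ?thesis
    by (simp add: sum_product mult_single)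
qed

lemma mpoly_eval_mult: "mpoly_eval (p * q) x = mpoly_eval p x * mpoly_eval q x"
proof -
  have "mpoly_eval (p * q) x = (\<Sum>m\<in>Poly_Mapping.keys p. \<Sum>n\<in>Poly_Mapping.keys q.
      mpoly_eval (Poly_Mapping.single (m + n) (Poly_Mapping.lookup p m * Poly_Mapping.lookup q n)) x)"
    by (subst poly_mapping_mult_sum_single) (simp add: mpoly_eval_sum)
  also have "\<dots> = mpoly_eval p x * mpoly_eval q x"
    unfolding mpoly_eval_def[of p] mpoly_eval_def[of q] sum_product
    by (intro sum.cong) (simp_all add: mpoly_eval_single monomial_value_add mult_ac)
  finally show ?thesis .
qed

text \<open>Used over the integers. Over the rationals divisibility of values says almost nothing,
  which is why the common divisor is first made integral.\<close>

lemma mpoly_eval_dvd: "p dvd q \<Longrightarrow> mpoly_eval p x dvd mpoly_eval q x"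
  by (auto elim!: dvdE simp: mpoly_eval_mult)


subsection \<open>Total degree and prime divisors of coefficients\<close>

lemma monomial_degree_le_total_degree:
  "m \<in> Poly_Mapping.keys p \<Longrightarrow> monomial_degree m \<le> total_degree p"
  unfolding total_degree_def by (intro Max_ge) auto

lemma total_degree_leI:
  "(\<And>m. m \<in> Poly_Mapping.keys p \<Longrightarrow> monomial_degree m \<le> b) \<Longrightarrow> total_degree p \<le> b"
  unfolding total_degree_def by (subst Max_le_iff) auto

lemma monomial_degree_superset:
  assumes "finite J" and "Poly_Mapping.keys m \<subseteq> J"
  shows "monomial_degree m = (\<Sum>j\<in>J. Poly_Mapping.lookup m j)"
  unfolding monomial_degree_def
  using assms by (intro sum.mono_neutral_left) (auto simp: in_keys_iff)

lemma monomial_degree_zero [simp]: "monomial_degree 0 = 0"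
  by (simp add: monomial_degree_def)

lemma monomial_degree_add: "monomial_degree (m + n) = monomial_degree m + monomial_degree n"
proof -
  let ?J = "Poly_Mapping.keys m \<union> Poly_Mapping.keys n"
  have "Poly_Mapping.keys (m + n) \<subseteq> ?J"
    by (rule Poly_Mapping.keys_add)
  then show ?thesis
    using monomial_degree_superset[of ?J "m + n"] monomial_degree_superset[of ?J m]
      monomial_degree_superset[of ?J n]
    by (simp add: lookup_add sum.distrib)
qed

text \<open>The leading monomial in the degree-lexicographic order.\<close>

lemma ex_max_monomial:
  fixes A :: "monomial set"
  assumes "finite A" and "A \<noteq> {}"
  obtains a where "a \<in> A"
    and "\<And>m. m \<in> A \<Longrightarrow> m \<noteq> a \<Longrightarrow>
      monomial_degree m < monomial_degree a \<or> monomial_degree m = monomial_degree a \<and> m < a"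
proof -
  \<comment> \<open>The degree is maximised first; ties are broken by the linear order on
    monomials.\<close>
  define d where "d = Max (monomial_degree ` A)"
  define B where "B = {m\<in>A. monomial_degree m = d}"
  have "d \<in> monomial_degree ` A"
    unfolding d_def using assms by (intro Max_in) auto
  then have B: "finite B" "B \<noteq> {}"
    using assms by (auto simp: B_def)
  have "Max B \<in> B"
    using B by (rule Max_in)
  moreover have "monomial_degree m < d \<or> monomial_degree m = d \<and> m < Max B"
    if m: "m \<in> A" "m \<noteq> Max B" for m
  proof -
    have "monomial_degree m \<le> d"
      unfolding d_def using assms m by (intro Max_ge) auto
    moreover have "m < Max B" if "monomial_degree m = d"
      using that m B Max_ge[of B m] by (auto simp: B_def order.strict_iff_order)
    ultimately show ?thesis by linarith
  qed
  ultimately show ?thesis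
    using that[of "Max B"] by (auto simp: B_def)
qed

text \<open>The case of prime \<open>q\<close> is Gauss's lemma, the case \<open>q = 0\<close> gives the degree of a product.\<close>

lemma ex_coeff_mult_not_dvd:
  fixes f g :: "int mpoly"
  assumes q: "\<And>a b. q dvd a * b \<Longrightarrow> q dvd a \<or> q dvd b"
    and f: "\<exists>m. \<not> q dvd Poly_Mapping.lookup f m"
    and g: "\<exists>m. \<not> q dvd Poly_Mapping.lookup g m"
  obtains a b where "\<not> q dvd Poly_Mapping.lookup (f * g) (a + b)"
    and "\<And>m. \<not> q dvd Poly_Mapping.lookup f m \<Longrightarrow> monomial_degree m \<le> monomial_degree a"
proof -
  \<comment> \<open>Only finitely many coefficients are not divisible by \<open>q\<close>, since
    \<open>q\<close> divides 0. The witness is the leading monomial among those that are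
    not.\<close>
  have ex: "\<exists>a. \<not> q dvd Poly_Mapping.lookup h a \<and> (\<forall>m. \<not> q dvd Poly_Mapping.lookup h m \<longrightarrow> m \<noteq> a \<longrightarrow>
      monomial_degree m < monomial_degree a \<or> monomial_degree m = monomial_degree a \<and> m < a)"
    if "\<exists>m. \<not> q dvd Poly_Mapping.lookup h m" for h :: "int mpoly"
  proof -
    have "{m. \<not> q dvd Poly_Mapping.lookup h m} \<subseteq> Poly_Mapping.keys h"
      by (auto simp: in_keys_iff)
    then have "finite {m. \<not> q dvd Poly_Mapping.lookup h m}"
      by (rule finite_subset) simp
    then show ?thesis
      using that ex_max_monomial[of "{m. \<not> q dvd Poly_Mapping.lookup h m}"]
      by (metis (mono_tags, lifting) empty_Collect_eq mem_Collect_eq)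
  qed
  obtain a where a: "\<not> q dvd Poly_Mapping.lookup f a"
    and a': "\<And>m. \<not> q dvd Poly_Mapping.lookup f m \<Longrightarrow> m \<noteq> a \<Longrightarrow>
      monomial_degree m < monomial_degree a \<or> monomial_degree m = monomial_degree a \<and> m < a"
    using ex[OF f] by blast
  obtain b where b: "\<not> q dvd Poly_Mapping.lookup g b"
    and b': "\<And>m. \<not> q dvd Poly_Mapping.lookup g m \<Longrightarrow> m \<noteq> b \<Longrightarrow>
      monomial_degree m < monomial_degree b \<or> monomial_degree m = monomial_degree b \<and> m < b"
    using ex[OF g] by blast
  let ?t = "\<lambda>(m, n). Poly_Mapping.lookup f m * Poly_Mapping.lookup g n when m + n = a + b"
  let ?K = "Poly_Mapping.keys f \<times> Poly_Mapping.keys g"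
  \<comment> \<open>Modulo \<open>q\<close> only the pair \<open>(a, b)\<close> contributes to the
    coefficient of \<open>a + b\<close>. In any other pair with this sum and both coefficients not
    divisible by \<open>q\<close>, the degrees would have to be equal to those of \<open>a\<close>
    and \<open>b\<close>, so both monomials would be strictly smaller in an order compatible with
    addition.\<close>
  have other: "q dvd ?t p" if "p \<in> ?K - {(a, b)}" for p
  proof -
    obtain m n where p: "p = (m, n)" by (cases p)
    have "q dvd Poly_Mapping.lookup f m \<or> q dvd Poly_Mapping.lookup g n" if s: "m + n = a + b"
    proof (rule ccontr)
      assume "\<not> ?thesis"
      then have nd: "\<not> q dvd Poly_Mapping.lookup f m" "\<not> q dvd Poly_Mapping.lookup g n"
        by auto
      have deg: "monomial_degree m + monomial_degree n = monomial_degree a + monomial_degree b"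
        using s by (metis monomial_degree_add)
      have "m \<noteq> a" "n \<noteq> b"
        using s p \<open>p \<in> ?K - {(a, b)}\<close> by auto
      then have "m < a" "n < b"
        using a'[OF nd(1)] b'[OF nd(2)] deg by auto
      then have "m + n < a + b"
        by (rule add_strict_mono)
      then show False using s by simp
    qed
    then show ?thesis
      by (auto simp: p when_def)
  qed
  have "Poly_Mapping.lookup (f * g) (a + b) = (\<Sum>p\<in>?K. ?t p)"
    by (subst poly_mapping_mult_sum_single)
      (simp add: lookup_sum lookup_single sum.cartesian_product case_prod_unfold)
  also have "\<dots> = ?t (a, b) + (\<Sum>p\<in>?K - {(a, b)}. ?t p)"
    using a b by (intro sum.remove) (auto simp: in_keys_iff)
  finally have "q dvd Poly_Mapping.lookup (f * g) (a + b) \<longleftrightarrow> q dvd ?t (a, b)"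
    using dvd_sum[of "?K - {(a, b)}" q ?t] other by (simp add: dvd_add_left_iff)
  then have "\<not> q dvd Poly_Mapping.lookup (f * g) (a + b)"
    using a b q by auto
  moreover have "monomial_degree m \<le> monomial_degree a"
    if "\<not> q dvd Poly_Mapping.lookup f m" for m
    using a'[OF that] by (cases "m = a") auto
  ultimately show ?thesis
    by (rule that)
qed

text \<open>Take \<open>q = 0\<close> in \<open>ex_coeff_mult_not_dvd\<close>:
  \<open>0 dvd u\<close> means \<open>u = 0\<close>, so the product has a nonzero coefficient at
  \<open>a + b\<close>, where \<open>a\<close> has the maximal degree in \<open>f\<close>.\<close>

lemma total_degree_le_if_dvd:
  fixes f p :: "int mpoly"
  assumes "f dvd p" and "p \<noteq> 0"
  shows "total_degree f \<le> total_degree p"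
proof -
  obtain g where p: "p = f * g"
    using assms(1) by (rule dvdE)
  have nz: "\<exists>m. Poly_Mapping.lookup h m \<noteq> 0" if "h \<noteq> 0" for h :: "int mpoly"
    using that by (metis lookup_zero poly_mapping_eqI)
  have "f \<noteq> 0" "g \<noteq> 0"
    using p assms by auto
  then have nz_fg: "\<exists>m. \<not> 0 dvd Poly_Mapping.lookup f m" "\<exists>m. \<not> 0 dvd Poly_Mapping.lookup g m"
    using nz by simp_all
  have "0 dvd u \<or> 0 dvd v" if "0 dvd u * v" for u v :: int
    using that by simp
  then obtain a b where "\<not> 0 dvd Poly_Mapping.lookup (f * g) (a + b)"
      and a: "\<And>m. \<not> 0 dvd Poly_Mapping.lookup f m \<Longrightarrow> monomial_degree m \<le> monomial_degree a"
    by (rule ex_coeff_mult_not_dvd[OF _ nz_fg]) blast+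
  then have "monomial_degree (a + b) \<le> total_degree p"
    by (intro monomial_degree_le_total_degree) (simp add: in_keys_iff p)
  then have "monomial_degree a \<le> total_degree p"
    by (simp add: monomial_degree_add)
  moreover have "monomial_degree m \<le> monomial_degree a" if "m \<in> Poly_Mapping.keys f" for m
    using a[of m] that by (simp add: in_keys_iff)
  ultimately show ?thesis
    by (intro total_degree_leI) (rule order.trans)
qed


subsection \<open>From rational to integral divisibility\<close>

lemma lookup_of_int_mult:
  fixes p :: "'a::monoid_add \<Rightarrow>\<^sub>0 'b::ring_1"
  shows "Poly_Mapping.lookup (of_int c * p) m = of_int c * Poly_Mapping.lookup p m"
proof -
  have "of_int c * p = Poly_Mapping.map ((*) (of_int c)) p"
    by (simp add: mult_map_scale_conv_mult)
  then show ?thesis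
    by (simp add: Poly_Mapping.map.rep_eq when_def)
qed

lemma lookup_rat_mpoly: "Poly_Mapping.lookup (rat_mpoly p) m = of_int (Poly_Mapping.lookup p m)"
  by (simp add: rat_mpoly_def Poly_Mapping.map.rep_eq when_def)

lemma keys_rat_mpoly: "Poly_Mapping.keys (rat_mpoly p) = Poly_Mapping.keys p"
  by (auto simp: in_keys_iff lookup_rat_mpoly)

lemma rat_mpoly_inject: "rat_mpoly p = rat_mpoly q \<longleftrightarrow> p = q"
  by (auto simp: poly_mapping_eq_iff lookup_rat_mpoly fun_eq_iff)

text \<open>The coefficient embedding is injective and keeps supports, so both double sums run over
  the same index sets.\<close>

lemma rat_mpoly_mult: "rat_mpoly (p * q) = rat_mpoly p * rat_mpoly q"
proof (rule poly_mapping_eqI)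
  fix k
  show "Poly_Mapping.lookup (rat_mpoly (p * q)) k = Poly_Mapping.lookup (rat_mpoly p * rat_mpoly q) k"
    unfolding lookup_rat_mpoly poly_mapping_mult_sum_single[of p q]
      poly_mapping_mult_sum_single[of "rat_mpoly p"]
    by (simp add: lookup_sum lookup_single keys_rat_mpoly lookup_rat_mpoly when_def if_distrib
        cong: if_cong)
qed

lemma rat_mpoly_of_int: "rat_mpoly (of_int c) = of_int c"
  by (rule poly_mapping_eqI) (simp add: lookup_rat_mpoly lookup_of_int when_def)

text \<open>The factor \<open>N\<close> is the product of the denominators of all nonzero
  coefficients.\<close>

lemma clear_denominators:
  fixes f :: "rat mpoly"
  obtains N F where "N \<noteq> 0" and "rat_mpoly F = of_int N * f"
proof -
  define N where "N = (\<Prod>m\<in>Poly_Mapping.keys f. snd (quotient_of (Poly_Mapping.lookup f m)))"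
  \<comment> \<open>The floor only converts the type: each \<open>of_int N * c\<close> is already an
    integer.\<close>
  define F :: "int mpoly" where "F = Poly_Mapping.map (\<lambda>c. \<lfloor>of_int N * c\<rfloor>) f"
  have "N \<noteq> 0"
    by (simp add: N_def) (metis quotient_of_denom_pos' less_irrefl)
  moreover have "rat_mpoly F = of_int N * f"
  proof (rule poly_mapping_eqI)
    fix m
    have "of_int N * Poly_Mapping.lookup f m \<in> \<int>"
    proof (cases "m \<in> Poly_Mapping.keys f")
      case True
      obtain a b where ab: "quotient_of (Poly_Mapping.lookup f m) = (a, b)"
        by (cases "quotient_of (Poly_Mapping.lookup f m)")
      have "b dvd N"
        unfolding N_def using True ab by (metis dvd_prodI finite_keys snd_conv)
      then obtain c where "N = b * c" ..
      moreover have "Poly_Mapping.lookup f m = of_int a / of_int b" "b \<noteq> 0"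
        using ab quotient_of_div quotient_of_denom_pos by fastforce+
      ultimately have "of_int N * Poly_Mapping.lookup f m = of_int (c * a)"
        by simp
      then show ?thesis by (metis Ints_of_int)
    qed (simp add: in_keys_iff)
    then show "Poly_Mapping.lookup (rat_mpoly F) m =
        Poly_Mapping.lookup (of_int N * f) m"
      by (auto simp: lookup_rat_mpoly lookup_of_int_mult F_def Poly_Mapping.map.rep_eq when_def
          elim: Ints_cases)
  qed
  ultimately show ?thesis
    by (rule that)
qed

text \<open>Here \<open>g\<close> is the content, the gcd of all coefficients. A prime
  \<open>q\<close> dividing every coefficient of \<open>G\<close> would make \<open>g * q\<close> a
  common divisor of the coefficients of \<open>F\<close>, hence a divisor of
  \<open>g\<close>.\<close>

lemma ex_primitive_part:
  fixes F :: "int mpoly"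
  assumes "F \<noteq> 0"
  obtains g G where "g \<noteq> 0" and "F = of_int g * G"
    and "\<And>q. prime q \<Longrightarrow> \<exists>m. \<not> q dvd Poly_Mapping.lookup G m"
proof -
  define g where "g = Gcd (range (Poly_Mapping.lookup F))"
  define G where "G = Poly_Mapping.map (\<lambda>c. c div g) F"
  obtain m0 where "Poly_Mapping.lookup F m0 \<noteq> 0"
    using assms by (metis lookup_zero poly_mapping_eqI)
  then have g: "g \<noteq> 0"
    unfolding g_def by auto
  have dvd: "g dvd Poly_Mapping.lookup F m" for m
    unfolding g_def by (simp add: Gcd_dvd)
  have lookup_F: "Poly_Mapping.lookup F m = g * Poly_Mapping.lookup G m" for m
    using dvd by (simp add: G_def Poly_Mapping.map.rep_eq when_def)
  have "F = of_int g * G"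
    by (rule poly_mapping_eqI) (simp add: lookup_of_int_mult lookup_F)
  moreover have "\<exists>m. \<not> q dvd Poly_Mapping.lookup G m" if "prime q" for q
  proof (rule ccontr)
    assume "\<nexists>m. \<not> q dvd Poly_Mapping.lookup G m"
    then have "g * q dvd Poly_Mapping.lookup F m" for m
      by (simp add: lookup_F mult_dvd_mono)
    then have "g * q dvd g"
      by (metis (no_types, lifting) Gcd_greatest g_def imageE)
    then have "q dvd 1"
      using g by simp
    then show False
      using \<open>prime q\<close> by auto
  qed
  ultimately show ?thesis
    using that g by blast
qed

text \<open>The prime factors of \<open>n\<close> are stripped one at a time. By Gauss's lemma a
  prime \<open>q\<close> dividing \<open>G * h\<close> with \<open>G\<close> primitive divides every
  coefficient of \<open>h\<close>, so it cancels on both sides.\<close>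

lemma primitive_dvd_cancel_const:
  fixes G h p :: "int mpoly"
  assumes G: "\<And>q. prime q \<Longrightarrow> \<exists>m. \<not> q dvd Poly_Mapping.lookup G m"
  shows "n \<noteq> 0 \<Longrightarrow> of_int n * p = G * h \<Longrightarrow> G dvd p"
proof (induction n arbitrary: h rule: prime_divisors_induct)
  case zero
  then show ?case by simp
next
  case (unit n)
  \<comment> \<open>The units are 1 and -1, so \<open>n\<close> is its own inverse.\<close>
  then have "n * n = 1"
    by (auto simp: abs_if split: if_splits)
  then have "p = of_int n * (of_int n * p)"
    by (simp add: mult.assoc[symmetric] of_int_mult[symmetric] del: of_int_mult)
  also have "\<dots> = G * (of_int n * h)"
    unfolding unit.prems(2) by (rule mult.left_commute)
  finally show ?case ..
next
  case (factor q n)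
  have "\<forall>m. q dvd Poly_Mapping.lookup h m"
  proof (rule ccontr)
    assume "\<not> (\<forall>m. q dvd Poly_Mapping.lookup h m)"
    then have "\<exists>m. \<not> q dvd Poly_Mapping.lookup h m"
      by simp
    from prime_dvd_multD[OF factor.hyps] G[OF factor.hyps] this
    obtain a b where "\<not> q dvd Poly_Mapping.lookup (G * h) (a + b)"
      by (rule ex_coeff_mult_not_dvd)
    moreover have "q dvd Poly_Mapping.lookup (G * h) (a + b)"
      unfolding factor.prems(2)[symmetric] lookup_of_int_mult by simp
    ultimately show False ..
  qed
  then have h: "h = of_int q * Poly_Mapping.map (\<lambda>c. c div q) h"
    by (intro poly_mapping_eqI) (simp add: lookup_of_int_mult Poly_Mapping.map.rep_eq when_def)
  have "of_int q * (of_int n * p) = of_int (q * n) * p"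
    by (simp add: mult.assoc)
  also have "\<dots> = G * h"
    by (fact factor.prems(2))
  also have "\<dots> = G * (of_int q * Poly_Mapping.map (\<lambda>c. c div q) h)"
    by (subst h) (rule refl)
  also have "\<dots> = of_int q * (G * Poly_Mapping.map (\<lambda>c. c div q) h)"
    by (rule mult.left_commute)
  finally have "of_int q * (of_int n * p) = of_int q * (G * Poly_Mapping.map (\<lambda>c. c div q) h)" .
  moreover have "of_int q \<noteq> (0 :: int mpoly)"
    using factor.hyps by auto
  ultimately have "of_int n * p = G * Poly_Mapping.map (\<lambda>c. c div q) h"
    by simp
  then show ?case
    using factor.IH factor.prems(1) by auto
qed

text \<open>\<open>G\<close> is the primitive part of a nonzero integer multiple of
  \<open>D\<close>. Equality of keys carries over both the variables that occur and the total
  degree.\<close>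

lemma ex_integral_divisor:
  fixes D :: "rat mpoly"
  assumes "D \<noteq> 0"
  obtains G :: "int mpoly" where "Poly_Mapping.keys G = Poly_Mapping.keys D"
    and "\<And>p. D dvd rat_mpoly p \<Longrightarrow> G dvd p"
proof -
  obtain N F where N: "N \<noteq> 0" and F: "rat_mpoly F = of_int N * D"
    by (rule clear_denominators)
  have keys_F: "Poly_Mapping.keys F = Poly_Mapping.keys D"
    unfolding keys_rat_mpoly[symmetric] F using N by (auto simp: in_keys_iff lookup_of_int_mult)
  then have "F \<noteq> 0"
    using assms by (metis keys_eq_empty keys_zero poly_mapping_sum_single sum.empty)
  then obtain g G where g: "g \<noteq> 0" and G: "F = of_int g * G"
    and prim: "\<And>q. prime q \<Longrightarrow> \<exists>m. \<not> q dvd Poly_Mapping.lookup G m"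
    using ex_primitive_part by blast
  have "Poly_Mapping.keys G = Poly_Mapping.keys D"
    unfolding keys_F[symmetric] G using g by (auto simp: in_keys_iff lookup_of_int_mult)
  moreover have "G dvd p" if "D dvd rat_mpoly p" for p
  proof -
    obtain c where c: "rat_mpoly p = D * c"
      using \<open>D dvd rat_mpoly p\<close> ..
    obtain M C where M: "M \<noteq> 0" and C: "rat_mpoly C = of_int M * c"
      by (rule clear_denominators)
    \<comment> \<open>\<open>N\<close> clears the denominators of \<open>D\<close> and
      \<open>M\<close> those of the cofactor \<open>c\<close>; the resulting constant is cancelled
      because \<open>G\<close> is primitive.\<close>
    have "rat_mpoly (of_int (N * M) * p) = rat_mpoly (F * C)"
      by (simp add: rat_mpoly_mult rat_mpoly_of_int F C c mult_ac)
    then have eq: "of_int (N * M) * p = G * (of_int g * C)"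
      unfolding rat_mpoly_inject G by (simp only: mult_ac)
    show ?thesis
    proof (rule primitive_dvd_cancel_const)
      show "N * M \<noteq> 0"
        using N M by simp
    qed (fact prim eq)+
  qed
  ultimately show ?thesis
    by (rule that)
qed


subsection \<open>The Schwartz--Zippel bound\<close>

text \<open>
  Monomials are indexed by an arbitrary set \<open>K\<close>; the separation hypothesis is inherited by the set
  of monomials of maximal degree in one variable, which makes the induction on \<open>I\<close> work.
\<close>

lemma schwartz_zippel_sum:
  fixes c :: "'k \<Rightarrow> 'a::idom" and a :: "'k \<Rightarrow> 'i \<Rightarrow> nat"
  assumes "finite I" and "finite S" and "S \<noteq> {}"
  shows "finite K \<Longrightarrow> K \<noteq> {} \<Longrightarrow> (\<And>k. k \<in> K \<Longrightarrow> c k \<noteq> 0) \<Longrightarrow>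
    (\<And>k k'. k \<in> K \<Longrightarrow> k' \<in> K \<Longrightarrow> (\<And>i. i \<in> I \<Longrightarrow> a k i = a k' i) \<Longrightarrow> k = k') \<Longrightarrow>
    (\<And>k. k \<in> K \<Longrightarrow> (\<Sum>i\<in>I. a k i) \<le> d) \<Longrightarrow>
    card {x \<in> I \<rightarrow>\<^sub>E S. (\<Sum>k\<in>K. c k * (\<Prod>i\<in>I. x i ^ a k i)) = 0} * card S \<le> d * card S ^ card I"
  using \<open>finite I\<close>
proof (induction I arbitrary: K d rule: finite_induct)
  case empty
  \<comment> \<open>Without variables the separation hypothesis leaves a single term, whose value
    \<open>c k\<close> is nonzero, so there are no zeros.\<close>
  then obtain k where "k \<in> K" by blast
  with empty.prems have "K = {k}" by blast
  with empty.prems show ?case by simp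
next
  case (insert i I)
  \<comment> \<open>\<open>e\<close> is the degree in the variable \<open>i\<close>, and
    \<open>L\<close> collects the terms forming the coefficient of its \<open>e\<close>-th
    power.\<close>
  define e where "e = Max ((\<lambda>k. a k i) ` K)"
  define L where "L = {k \<in> K. a k i = e}"
  have "e \<in> (\<lambda>k. a k i) ` K"
    unfolding e_def using insert.prems by (intro Max_in) auto
  then have L: "finite L" "L \<noteq> {}" "L \<subseteq> K"
    using insert.prems(1) by (auto simp: L_def)
  have le_e: "a k i \<le> e" if "k \<in> K" for k
    unfolding e_def using insert.prems that by (intro Max_ge) auto
  have deg_L: "(\<Sum>j\<in>I. a k j) \<le> d - e" "e \<le> d" if "k \<in> L" for k
    using insert.prems(5)[of k] that insert.hyps by (auto simp: L_def)
  define Z where "Z = {x \<in> I \<rightarrow>\<^sub>E S. (\<Sum>k\<in>L. c k * (\<Prod>j\<in>I. x j ^ a k j)) = 0}"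
  have fin_PiE: "finite (I \<rightarrow>\<^sub>E S)"
    using insert.hyps assms by (intro finite_PiE) auto
  have Z: "card Z * card S \<le> (d - e) * card S ^ card I"
    unfolding Z_def
  proof (rule insert.IH)
    \<comment> \<open>On \<open>L\<close> the exponents of \<open>i\<close> all equal
      \<open>e\<close>, so the exponents in \<open>I\<close> alone already separate.\<close>
    show "k = k'" if kk': "k \<in> L" "k' \<in> L" "\<And>j. j \<in> I \<Longrightarrow> a k j = a k' j" for k k'
    proof (rule insert.prems(4))
      show "a k j = a k' j" if "j \<in> insert i I" for j
        using that kk' by (auto simp: L_def)
    qed (use kk' L in auto)
  qed (use L insert.prems deg_L in auto)
  \<comment> \<open>\<open>Q x\<close> is the univariate polynomial in the variable \<open>i\<close>
    left after fixing the others at \<open>x\<close>; its coefficient at \<open>e\<close> vanishes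
    on the grid exactly for \<open>x\<close> in \<open>Z\<close>.\<close>
  define Q where "Q = (\<lambda>x. \<Sum>k\<in>K. monom (c k * (\<Prod>j\<in>I. x j ^ a k j)) (a k i))"
  have poly_Q: "poly (Q x) t = (\<Sum>k\<in>K. c k * (\<Prod>j\<in>insert i I. (x(i := t)) j ^ a k j))" for x t
  proof -
    have "(\<Prod>j\<in>I. (x(i := t)) j ^ a k j) = (\<Prod>j\<in>I. x j ^ a k j)" for k
      using insert.hyps by (intro prod.cong) auto
    then show ?thesis
      using insert.hyps by (simp add: Q_def poly_sum poly_monom mult_ac)
  qed
  have coeff_Q: "coeff (Q x) e = (\<Sum>k\<in>L. c k * (\<Prod>j\<in>I. x j ^ a k j))" for x
    unfolding Q_def coeff_sum coeff_monom L_def using insert.prems(1)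
    by (simp add: sum.inter_filter)
  have deg_Q: "degree (Q x) \<le> e" for x
    unfolding Q_def using insert.prems(1) le_e
    by (intro degree_sum_le) (auto intro: order.trans[OF degree_monom_le])
  \<comment> \<open>\<open>R x\<close> bounds the fibre of zeros above \<open>x\<close>: all of
    \<open>S\<close> over \<open>Z\<close>, and at most \<open>e\<close> roots elsewhere.\<close>
  define R where "R = (\<lambda>x. {t \<in> S. x \<in> Z \<or> poly (Q x) t = 0})"
  have fin_R: "finite (R x)" for x
    using assms by (simp add: R_def)
  have card_R: "card (R x) \<le> (if x \<in> Z then card S else e)" if x: "x \<in> I \<rightarrow>\<^sub>E S" for x
  proof (cases "x \<in> Z")
    case False
    then have "coeff (Q x) e \<noteq> 0"
      using x by (simp add: Z_def coeff_Q)
    then have "Q x \<noteq> 0" by auto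
    then have "card {t. poly (Q x) t = 0} \<le> e"
      using deg_Q[of x] card_poly_roots_bound[of "Q x"] by simp
    moreover have "card (R x) \<le> card {t. poly (Q x) t = 0}"
      using False \<open>Q x \<noteq> 0\<close> by (intro card_mono poly_roots_finite) (auto simp: R_def)
    ultimately show ?thesis
      using False by simp
  qed (simp add: R_def)
  let ?A = "{x \<in> insert i I \<rightarrow>\<^sub>E S. (\<Sum>k\<in>K. c k * (\<Prod>j\<in>insert i I. x j ^ a k j)) = 0}"
  let ?B = "SIGMA x:I \<rightarrow>\<^sub>E S. R x"
  have "?A \<subseteq> (\<lambda>(x, t). x(i := t)) ` ?B"
  proof
    fix y assume y: "y \<in> ?A"
    then obtain t x where *: "y = x(i := t)" "x \<in> I \<rightarrow>\<^sub>E S" "t \<in> S"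
      unfolding PiE_insert_eq by auto
    with y have "t \<in> R x"
      by (simp add: R_def poly_Q del: fun_upd_apply)
    with * show "y \<in> (\<lambda>(x, t). x(i := t)) ` ?B"
      by force
  qed
  moreover have "finite ?B"
    using fin_PiE fin_R by blast
  ultimately have "card ?A \<le> card ?B"
    by (rule surj_card_le[rotated])
  also have "card ?B = (\<Sum>x\<in>I \<rightarrow>\<^sub>E S. card (R x))"
    using fin_PiE fin_R by (simp add: card_SigmaI)
  \<comment> \<open>Counting \<open>e\<close> over \<open>Z\<close> as well is harmless: the two
    parts are still bounded by \<open>d - e\<close> and \<open>e\<close> times
    \<open>card S ^ card I\<close>.\<close>
  also have "\<dots> \<le> (\<Sum>x\<in>I \<rightarrow>\<^sub>E S. (if x \<in> Z then card S else 0) + e)"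
  proof (rule sum_mono)
    fix x assume "x \<in> I \<rightarrow>\<^sub>E S"
    from card_R[OF this] show "card (R x) \<le> (if x \<in> Z then card S else 0) + e"
      by (simp split: if_splits)
  qed
  also have "\<dots> = (\<Sum>x\<in>I \<rightarrow>\<^sub>E S. if x \<in> Z then card S else 0) + card S ^ card I * e"
    using insert.hyps by (simp add: sum.distrib card_PiE)
  also have "(\<Sum>x\<in>I \<rightarrow>\<^sub>E S. if x \<in> Z then card S else 0) = card Z * card S"
  proof -
    have "(I \<rightarrow>\<^sub>E S) \<inter> Z = Z"
      by (auto simp: Z_def)
    then show ?thesis
      using fin_PiE by (simp add: sum.If_cases Int_def)
  qed
  also have "card Z * card S + card S ^ card I * e \<le> (d - e) * card S ^ card I + card S ^ card I * e"
    using Z by simp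
  \<comment> \<open>Subtraction is truncated here; \<open>e \<le> d\<close> comes from any element
    of the nonempty \<open>L\<close>.\<close>
  also have "\<dots> = d * card S ^ card I"
    using deg_L(2) L(2) by (metis ex_in_conv add_mult_distrib le_add_diff_inverse2 mult.commute)
  finally show ?case
    using insert.hyps by simp
qed

text \<open>The index set is the set of monomials of \<open>p\<close>, which are separated by their
  exponents in \<open>{1..r}\<close> as no other variable occurs. The factor \<open>card S\<close>
  on the left avoids the exponent \<open>r - 1\<close>.\<close>

lemma schwartz_zippel:
  fixes p :: "'a::idom mpoly"
  assumes "p \<in> mpolys r" and "p \<noteq> 0" and "finite S" and "S \<noteq> {}"
  shows "card {x \<in> {1..r} \<rightarrow>\<^sub>E S. mpoly_eval p x = 0} * card S \<le> total_degree p * card S ^ r"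
proof -
  have keys: "Poly_Mapping.keys m \<subseteq> {1..r}" if "m \<in> Poly_Mapping.keys p" for m
    using assms that by (auto simp: mpolys_def)
  have "mpoly_eval p x = (\<Sum>m\<in>Poly_Mapping.keys p.
      Poly_Mapping.lookup p m * (\<Prod>j\<in>{1..r}. x j ^ Poly_Mapping.lookup m j))" for x
    unfolding mpoly_eval_def
    using keys by (intro sum.cong refl arg_cong2[of _ _ _ _ "(*)"] monomial_value_superset) auto
  moreover have "card {x \<in> {1..r} \<rightarrow>\<^sub>E S. (\<Sum>m\<in>Poly_Mapping.keys p.
      Poly_Mapping.lookup p m * (\<Prod>j\<in>{1..r}. x j ^ Poly_Mapping.lookup m j)) = 0} * card S
      \<le> total_degree p * card S ^ card {1..r}"
  proof (rule schwartz_zippel_sum)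
    show "Poly_Mapping.keys p \<noteq> {}"
      using assms(2) poly_mapping_sum_single[of p] by auto
    show "m = m'" if "m \<in> Poly_Mapping.keys p" "m' \<in> Poly_Mapping.keys p"
      "\<And>i. i \<in> {1..r} \<Longrightarrow> Poly_Mapping.lookup m i = Poly_Mapping.lookup m' i" for m m'
      using that keys by (intro poly_mapping_eqI) (metis in_keys_iff subsetD)
    show "(\<Sum>i\<in>{1..r}. Poly_Mapping.lookup m i) \<le> total_degree p" if "m \<in> Poly_Mapping.keys p" for m
      using monomial_degree_le_total_degree[OF that] monomial_degree_superset[OF _ keys[OF that]]
      by simp
  qed (use assms in \<open>auto simp: in_keys_iff\<close>)
  ultimately show ?thesis by simp
qed

text \<open>Apply the bound for zeros to \<open>p - c\<close>. Positive degree guarantees that this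
  difference is nonzero for every \<open>c\<close>.\<close>

lemma schwartz_zippel_level:
  fixes p :: "'a::idom mpoly"
  assumes "p \<in> mpolys r" and "total_degree p > 0" and "finite S" and "S \<noteq> {}"
  shows "card {x \<in> {1..r} \<rightarrow>\<^sub>E S. mpoly_eval p x = c} * card S \<le> total_degree p * card S ^ r"
proof -
  define q where "q = p - Poly_Mapping.single 0 c"
  have keys_q: "m = 0 \<or> m \<in> Poly_Mapping.keys p" if "m \<in> Poly_Mapping.keys q" for m
    using that by (auto simp: q_def in_keys_iff lookup_minus lookup_single when_def split: if_splits)
  have "q \<in> mpolys r"
    using assms(1) keys_q by (fastforce simp: mpolys_def)
  moreover have "total_degree q \<le> total_degree p"
    using keys_q monomial_degree_le_total_degree[of _ p] by (intro total_degree_leI) fastforce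
  moreover have "q \<noteq> 0"
    using assms(2) by (auto simp: q_def total_degree_def split: if_splits)
  moreover have "mpoly_eval p x = c \<longleftrightarrow> mpoly_eval q x = 0" for x
    by (simp add: q_def mpoly_eval_diff mpoly_eval_single)
  ultimately show ?thesis
    using schwartz_zippel[of q r S] assms mult_le_mono1 by (auto intro: order.trans)
qed

section \<open>Counting grid points with small gcd\<close>

theorem theorem1p9:
  fixes r s :: nat
    and P :: "nat \<Rightarrow> int mpoly"
    and S :: "int set"
    and k :: real
    and l :: nat
    and d :: "(nat \<Rightarrow> int) \<Rightarrow> int"
  assumes "r \<ge> 1" and "s \<ge> 2"
    and "\<And>i. i \<in> {1..s} \<Longrightarrow> P i \<in> mpolys r"
    and "\<And>i. i \<in> {1..s} \<Longrightarrow> P i \<noteq> 0"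
    and "l = Max ((\<lambda>i. total_degree (P i)) ` {1..s})"
    and "finite S" and "S \<noteq> {}"
    and "k > 0"
    and "\<And>n. d n = Gcd ((\<lambda>i. mpoly_eval (P i) n) ` {1..s})"
    and "real (card {n \<in> {1..r} \<rightarrow>\<^sub>E S. real_of_int (d n) \<le> k}) / real (card ({1..r} \<rightarrow>\<^sub>E S))
          > (2 * k + 1) * real l / real (card S)"
  shows "coprime_mpolys r (P ` {1..s})"
proof (rule ccontr)
  assume "\<not> coprime_mpolys r (P ` {1..s})"
  then obtain D where D: "D \<in> mpolys r" "total_degree D > 0"
    and dvd: "\<And>i. i \<in> {1..s} \<Longrightarrow> D dvd rat_mpoly (P i)"
    unfolding coprime_mpolys_def mpoly_dvd_def by (fastforce intro: dvdI)
  \<comment> \<open>The zero polynomial has total degree 0 by convention.\<close>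
  from D have "D \<noteq> 0"
    by (auto simp: total_degree_def)
  then obtain G where keys_G: "Poly_Mapping.keys G = Poly_Mapping.keys D"
    and G: "\<And>p. D dvd rat_mpoly p \<Longrightarrow> G dvd p"
    using ex_integral_divisor by blast
  have G': "G \<in> mpolys r" "total_degree G > 0"
    using D by (simp_all add: mpolys_def total_degree_def keys_G)
  have deg_P: "total_degree (P i) \<le> l" if "i \<in> {1..s}" for i
    using assms(5) that by (auto intro: Max_ge)
  have one: "1 \<in> {1..s}"
    using assms(2) by simp
  have deg_G: "total_degree G \<le> l"
    using total_degree_le_if_dvd[OF G[OF dvd[OF one]] assms(4)[OF one]] deg_P[OF one] by simp
  define q where "q = card S"
  have q: "q > 0"
    using assms by (simp add: q_def card_gt_0_iff)
  \<comment> \<open>\<open>C\<close> holds the nonzero values that \<open>G\<close> may take where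
    \<open>d n \<le> k\<close>, and \<open>V c\<close> is the corresponding level set;
    \<open>Z\<close> absorbs the points with \<open>d n = 0\<close>.\<close>
  define C where "C = {c :: int. c \<noteq> 0 \<and> \<bar>real_of_int c\<bar> \<le> k}"
  define V where "V = (\<lambda>c. {n \<in> {1..r} \<rightarrow>\<^sub>E S. mpoly_eval G n = c})"
  define Z where "Z = {n \<in> {1..r} \<rightarrow>\<^sub>E S. mpoly_eval (P 1) n = 0}"
  have C_eq: "C = {-\<lfloor>k\<rfloor>..-1} \<union> {1..\<lfloor>k\<rfloor>}"
    unfolding C_def by (auto simp: abs_le_iff le_floor_iff minus_le_iff)
  have "finite C"
    by (simp add: C_eq)
  have "card C \<le> nat \<lfloor>k\<rfloor> + nat \<lfloor>k\<rfloor>"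
    unfolding C_eq by (rule order.trans[OF card_Un_le]) simp
  then have card_C: "real (card C) \<le> 2 * k"
    using assms(8) by linarith
  have fin: "finite ({1..r} \<rightarrow>\<^sub>E S)"
    using assms by (intro finite_PiE) auto
  let ?B = "{n \<in> {1..r} \<rightarrow>\<^sub>E S. real_of_int (d n) \<le> k}"
  have "?B \<subseteq> Z \<union> (\<Union>c\<in>C. V c)"
  proof
    fix n assume n: "n \<in> ?B"
    have "d n dvd mpoly_eval (P 1) n"
      unfolding assms(9) using one by (intro Gcd_dvd) auto
    moreover have "mpoly_eval G n dvd d n"
      unfolding assms(9) using G dvd by (auto intro!: Gcd_greatest mpoly_eval_dvd)
    moreover have "d n \<ge> 0"
      unfolding assms(9) by simp
    \<comment> \<open>If \<open>d n = 0\<close>, then 0 divides the value of \<open>P 1\<close>.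
      Otherwise the value of \<open>G\<close> divides a positive integer, so it is nonzero and at
      most \<open>d n\<close> in absolute value.\<close>
    ultimately have "mpoly_eval (P 1) n = 0 \<or> mpoly_eval G n \<noteq> 0 \<and> \<bar>mpoly_eval G n\<bar> \<le> d n"
      by (cases "d n = 0") (auto dest: dvd_imp_le_int)
    then show "n \<in> Z \<union> (\<Union>c\<in>C. V c)"
      using n by (auto simp: Z_def V_def C_def)
  qed
  moreover have "finite (Z \<union> (\<Union>c\<in>C. V c))"
    using \<open>finite C\<close> fin by (auto simp: Z_def V_def)
  ultimately have "card ?B \<le> card (Z \<union> (\<Union>c\<in>C. V c))"
    by (intro card_mono)
  also have "\<dots> \<le> card Z + (\<Sum>c\<in>C. card (V c))"
    by (rule order.trans[OF card_Un_le add_left_mono[OF card_UN_le[OF \<open>finite C\<close>]]])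
  finally have "card ?B * q \<le> card Z * q + (\<Sum>c\<in>C. card (V c) * q)"
    unfolding sum_distrib_right[symmetric] add_mult_distrib[symmetric] by (rule mult_le_mono1)
  \<comment> \<open>\<open>Z\<close> is controlled by the degree of the nonzero \<open>P 1\<close>,
    each \<open>V c\<close> by the positive degree of \<open>G\<close>; both degrees are at most
    \<open>l\<close>.\<close>
  also have "\<dots> \<le> l * q ^ r + (\<Sum>c\<in>C. l * q ^ r)"
  proof (intro add_mono sum_mono)
    show "card Z * q \<le> l * q ^ r"
      using schwartz_zippel[OF assms(3)[OF one] assms(4)[OF one] assms(6,7)] deg_P[OF one]
      unfolding Z_def q_def by (meson mult_le_mono1 order.trans)
    show "card (V c) * q \<le> l * q ^ r" for c
      using schwartz_zippel_level[OF G' assms(6,7)] deg_G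
      unfolding V_def q_def by (meson mult_le_mono1 order.trans)
  qed
  finally have "real (card ?B * q) \<le> real (l * q ^ r + card C * (l * q ^ r))"
    by (simp only: sum_constant of_nat_id of_nat_le_iff)
  also have "\<dots> = (real (card C) + 1) * (real l * real q ^ r)"
    by (simp add: algebra_simps)
  also have "\<dots> \<le> (2 * k + 1) * (real l * real q ^ r)"
    using card_C by (intro mult_right_mono) auto
  finally have "real (card ?B) / real q ^ r \<le> (2 * k + 1) * real l / real q"
    using q by (simp add: field_simps)
  moreover have "real (card ({1..r} \<rightarrow>\<^sub>E S)) = real q ^ r"
    by (simp add: card_PiE q_def)
  ultimately show False
    using assms(10) by (simp add: q_def)
qed

end
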